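(* There exists a structure $\mathcal{V}^{\star}=(V^{\star},\in^{\star})$, with $\in^{\star}$ a binary relation on the set $V^{\star}$, which is a model of $\mathsf{WD}+\mathsf{EXT}+\mathsf{BU}+\mathsf{BI}$ and such that $(\mathcal{V}^{\star},a)\simeq(\mathcal{V}^{\star},b)$ for any two elements $a,b$ of $V^{\star}$, i.e. for all $a,b\in V^{\star}$ there is an automorphism $F$ of $\mathcal{V}^{\star}$ with $F(a)=b$.
   Context: All theories are in the first-order language with one binary relation symbol $\in$. $\mathsf{WD}$ is the theory with the two axioms $\forall x y\,\exists z\,\forall u\,[u\in z\leftrightarrow(u\in x\vee u=y)]$ and $\forall x y\,\exists z\,\forall u\,[u\in z\leftrightarrow(u\in x\wedge u\neq y)]$. $\mathsf{EXT}$ is extensionality $\forall x y\,[\forall u\,(u\in x\leftrightarrow u\in y)\rightarrow x=y]$. $\mathsf{BU}$ is $\forall x y\,\exists z\,\forall u\,[u\in z\leftrightarrow(u\in x\vee u\in y)]$ and $\mathsf{BI}$ is $\forall x y\,\exists z\,\forall u\,[u\in z\leftrightarrow(u\in x\wedge u\in y)]$. *)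

theory Defs
  imports Main
begin

section \<open>First-order language of set theory\<close>

datatype fm =
    Mem nat nat
  | Eq nat nat
  | Neg fm
  | Conj fm fm
  | Disj fm fm
  | Imp fm fm
  | Iff fm fm
  | All nat fm
  | Ex nat fm

text \<open>A structure is a nonempty set with a binary relation on it; a pair \<open>(u, x) \<in> E\<close>
  means that \<open>u\<close> is a member of \<open>x\<close> in the structure. Nonemptiness is the usual convention of
  first-order logic; without it the empty structure would satisfy every theory below.\<close>

definition is_structure :: "'a set \<Rightarrow> 'a rel \<Rightarrow> bool" where
  "is_structure V E \<longleftrightarrow> V \<noteq> {} \<and> E \<subseteq> V \<times> V"

primrec sat :: "'a set \<Rightarrow> 'a rel \<Rightarrow> (nat \<Rightarrow> 'a) \<Rightarrow> fm \<Rightarrow> bool" where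
  "sat V E s (Mem i j) \<longleftrightarrow> (s i, s j) \<in> E"
| "sat V E s (Eq i j) \<longleftrightarrow> s i = s j"
| "sat V E s (Neg p) \<longleftrightarrow> \<not> sat V E s p"
| "sat V E s (Conj p q) \<longleftrightarrow> sat V E s p \<and> sat V E s q"
| "sat V E s (Disj p q) \<longleftrightarrow> sat V E s p \<or> sat V E s q"
| "sat V E s (Imp p q) \<longleftrightarrow> (sat V E s p \<longrightarrow> sat V E s q)"
| "sat V E s (Iff p q) \<longleftrightarrow> (sat V E s p \<longleftrightarrow> sat V E s q)"
| "sat V E s (All i p) \<longleftrightarrow> (\<forall>a\<in>V. sat V E (s(i := a)) p)"
| "sat V E s (Ex i p) \<longleftrightarrow> (\<exists>a\<in>V. sat V E (s(i := a)) p)"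

definition models :: "'a set \<Rightarrow> 'a rel \<Rightarrow> fm set \<Rightarrow> bool" where
  "models V E T \<longleftrightarrow> (\<forall>p\<in>T. \<forall>s. range s \<subseteq> V \<longrightarrow> sat V E s p)"


section \<open>The axioms\<close>

text \<open>Variables: \<open>x\<close> is 0, \<open>y\<close> is 1, \<open>z\<close> is 2, \<open>u\<close> is 3.\<close>

definition WD :: "fm set" where
  "WD =
    {All 0 (All 1 (Ex 2 (All 3 (Iff (Mem 3 2) (Disj (Mem 3 0) (Eq 3 1)))))),
     All 0 (All 1 (Ex 2 (All 3 (Iff (Mem 3 2) (Conj (Mem 3 0) (Neg (Eq 3 1)))))))}"

definition EXT :: "fm set" where
  "EXT = {All 0 (All 1 (Imp (All 3 (Iff (Mem 3 0) (Mem 3 1))) (Eq 0 1)))}"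

definition BU :: "fm set" where
  "BU = {All 0 (All 1 (Ex 2 (All 3 (Iff (Mem 3 2) (Disj (Mem 3 0) (Mem 3 1))))))}"

definition BI :: "fm set" where
  "BI = {All 0 (All 1 (Ex 2 (All 3 (Iff (Mem 3 2) (Conj (Mem 3 0) (Mem 3 1))))))}"


section \<open>Isomorphism\<close>

definition isomorphism ::
    "('a \<Rightarrow> 'b) \<Rightarrow> 'a set \<Rightarrow> 'a rel \<Rightarrow> 'b set \<Rightarrow> 'b rel \<Rightarrow> bool" where
  "isomorphism F V E W R \<longleftrightarrow>
    bij_betw F V W \<and> (\<forall>u\<in>V. \<forall>x\<in>V. (u, x) \<in> E \<longleftrightarrow> (F u, F x) \<in> R)"

definition automorphism :: "('a \<Rightarrow> 'a) \<Rightarrow> 'a set \<Rightarrow> 'a rel \<Rightarrow> bool" where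
  "automorphism F V E \<longleftrightarrow> isomorphism F V E V E"


section \<open>Semantic reading of the axioms\<close>

lemma models_Un: "models V E (S \<union> T) \<longleftrightarrow> models V E S \<and> models V E T"
  unfolding models_def by blast

lemma ex_assignment:
  assumes "is_structure V E"
  shows "\<exists>s :: nat \<Rightarrow> 'a. range s \<subseteq> (V :: 'a set)"
proof -
  obtain a where "a \<in> V" using assms unfolding is_structure_def by blast
  then have "range (\<lambda>_ :: nat. a) \<subseteq> V" by blast
  then show ?thesis by blast
qed

lemma models_WD_iff:
  assumes "is_structure V E"
  shows "models V E WD \<longleftrightarrow>
    (\<forall>x\<in>V. \<forall>y\<in>V. \<exists>z\<in>V. \<forall>u\<in>V. (u, z) \<in> E \<longleftrightarrow> (u, x) \<in> E \<or> u = y) \<and>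
    (\<forall>x\<in>V. \<forall>y\<in>V. \<exists>z\<in>V. \<forall>u\<in>V. (u, z) \<in> E \<longleftrightarrow> (u, x) \<in> E \<and> u \<noteq> y)"
  using ex_assignment[OF assms] by (simp add: models_def WD_def)

lemma models_EXT_iff:
  assumes "is_structure V E"
  shows "models V E EXT \<longleftrightarrow>
    (\<forall>x\<in>V. \<forall>y\<in>V. (\<forall>u\<in>V. (u, x) \<in> E \<longleftrightarrow> (u, y) \<in> E) \<longrightarrow> x = y)"
  using ex_assignment[OF assms] by (simp add: models_def EXT_def)

lemma models_BU_iff:
  assumes "is_structure V E"
  shows "models V E BU \<longleftrightarrow>
    (\<forall>x\<in>V. \<forall>y\<in>V. \<exists>z\<in>V. \<forall>u\<in>V. (u, z) \<in> E \<longleftrightarrow> (u, x) \<in> E \<or> (u, y) \<in> E)"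
  using ex_assignment[OF assms] by (simp add: models_def BU_def)

lemma models_BI_iff:
  assumes "is_structure V E"
  shows "models V E BI \<longleftrightarrow>
    (\<forall>x\<in>V. \<forall>y\<in>V. \<exists>z\<in>V. \<forall>u\<in>V. (u, z) \<in> E \<longleftrightarrow> (u, x) \<in> E \<and> (u, y) \<in> E)"
  using ex_assignment[OF assms] by (simp add: models_def BI_def)

end

theory Submission
  imports Defs "HOL-Library.Countable_Set"
begin

text \<open>The elements are those of a free group \<open>G\<close>, with \<open>u\<close> a member of \<open>v\<close> iff \<open>v\<^sup>-\<^sup>1 u \<in> S\<close>, so that left
  translations act transitively by automorphisms and the extension of \<open>v\<close> is \<open>v S\<close>. The subset \<open>S\<close> is chosen
  such that every translate \<open>v S\<close> differs from \<open>S\<close> in a finite set and, conversely, every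
  finite modification of \<open>S\<close> is \<open>v S\<close> for exactly one \<open>v\<close>; finite modifications of a
  fixed set are closed under union, intersection and changing one element, which gives all the axioms.
  To obtain \<open>S\<close>, generators \<open>x\<^sub>n\<close> are added one at a time: the values of \<open>S\<close> on the new words
  can be set so that \<open>x\<^sub>n S\<close> differs from \<open>S\<close> in any prescribed finite set of old words, and this is done
  exactly for those modifications that are not yet of the form \<open>v S\<close>.\<close>

section \<open>Reduced words\<close>

type_synonym letter = "nat \<times> bool"

definition flip :: "letter \<Rightarrow> letter" where
  "flip l = (fst l, \<not> snd l)"

definition reduced :: "letter list \<Rightarrow> bool" where
  "reduced = successively (\<lambda>a b. b \<noteq> flip a)"

definition step :: "letter \<Rightarrow> letter list \<Rightarrow> letter list" where
  "step l w = (if w \<noteq> [] \<and> hd w = flip l then tl w else l # w)"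

text \<open>\<open>step l\<close> is left multiplication by a letter on normal forms, so
  \<open>act p\<close> is left multiplication by the group element that \<open>p\<close> spells,
  reduced or not.\<close>

definition act :: "letter list \<Rightarrow> letter list \<Rightarrow> letter list" where
  "act p = foldr step p"

definition inv_word :: "letter list \<Rightarrow> letter list" where
  "inv_word p = rev (map flip p)"

lemma flip_flip [simp]: "flip (flip l) = l"
  by (simp add: flip_def)

lemma fst_flip [simp]: "fst (flip l) = fst l"
  by (simp add: flip_def)

lemma snd_flip [simp]: "snd (flip l) \<longleftrightarrow> \<not> snd l"
  by (simp add: flip_def)

lemma flip_neq [simp]: "flip l \<noteq> l" "l \<noteq> flip l"
  by (metis snd_flip)+

lemma reduced_Nil [simp]: "reduced []"
  by (simp add: reduced_def)

lemma reduced_Cons: "reduced (l # w) \<longleftrightarrow> reduced w \<and> (w \<noteq> [] \<longrightarrow> hd w \<noteq> flip l)"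
  by (cases w) (auto simp: reduced_def)

lemma reduced_append:
  "reduced (p @ q) \<longleftrightarrow> reduced p \<and> reduced q \<and> (p \<noteq> [] \<longrightarrow> q \<noteq> [] \<longrightarrow> hd q \<noteq> flip (last p))"
  by (auto simp: reduced_def successively_append_iff)

lemma step_cases:
  assumes "reduced w"
  obtains "step l w = l # w" "reduced (l # w)"
  | w' where "w = flip l # w'" "step l w = w'" "reduced w'"
  using assms by (cases w) (auto simp: step_def reduced_Cons split: if_splits)

lemma reduced_step [simp]: "reduced w \<Longrightarrow> reduced (step l w)"
  by (cases rule: step_cases[of w l]) auto

lemma step_reduced_Cons: "reduced (l # w) \<Longrightarrow> step l w = l # w"
  by (auto simp: step_def reduced_Cons)

lemma step_flip_Cons [simp]: "step (flip l) (l # w) = w" "step l (flip l # w) = w"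
  by (simp_all add: step_def)

lemma step_flip_step [simp]: "reduced w \<Longrightarrow> step (flip l) (step l w) = w"
  by (cases rule: step_cases[of w l]) (auto simp: step_reduced_Cons)

lemma step_step_flip [simp]: "reduced w \<Longrightarrow> step l (step (flip l) w) = w"
  using step_flip_step[of w "flip l"] by simp

lemma act_Nil [simp]: "act [] w = w"
  by (simp add: act_def)

lemma act_Cons [simp]: "act (l # p) w = step l (act p w)"
  by (simp add: act_def)

lemma act_append [simp]: "act (p @ q) w = act p (act q w)"
  by (simp add: act_def)

lemma reduced_act [simp]: "reduced w \<Longrightarrow> reduced (act p w)"
  by (induction p) auto

lemma act_reduced: "reduced (p @ w) \<Longrightarrow> act p w = p @ w"
  by (induction p) (auto simp: reduced_Cons step_def)

lemma act_right_Nil: "reduced p \<Longrightarrow> act p [] = p"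
  using act_reduced[of p "[]"] by simp

lemma act_step: "reduced w \<Longrightarrow> reduced q \<Longrightarrow> act (step l q) w = step l (act q w)"
  by (cases rule: step_cases[of q l]) auto

text \<open>Associativity of the group product: a cancellation inside \<open>act p q\<close> removes
  a pair of mutually inverse translations.\<close>

lemma act_act: "reduced w \<Longrightarrow> reduced q \<Longrightarrow> act (act p q) w = act p (act q w)"
  by (induction p) (auto simp: act_step)

text \<open>The hypotheses make \<open>w\<close> cyclically reduced, so nothing cancels where two
  copies meet.\<close>

lemma reduced_concat_replicate:
  assumes "reduced w" "hd w \<noteq> flip (last w)"
  shows "reduced (concat (replicate k w))"
proof (induction k)
  case (Suc k)
  have "concat (replicate k w) \<noteq> [] \<Longrightarrow> hd (concat (replicate k w)) = hd w"
    by (cases k) (auto simp: hd_append)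
  with Suc assms show ?case by (auto simp: reduced_append)
qed simp

lemma inv_word_Nil [simp]: "inv_word [] = []"
  by (simp add: inv_word_def)

lemma inv_word_Cons [simp]: "inv_word (l # p) = inv_word p @ [flip l]"
  by (simp add: inv_word_def)

lemma inv_word_append [simp]: "inv_word (p @ q) = inv_word q @ inv_word p"
  by (simp add: inv_word_def)

lemma inv_word_inv_word [simp]: "inv_word (inv_word p) = p"
  by (simp add: inv_word_def rev_map comp_def)

lemma length_inv_word [simp]: "length (inv_word p) = length p"
  by (simp add: inv_word_def)

lemma inv_word_eq_Nil [simp]: "inv_word p = [] \<longleftrightarrow> p = []"
  by (simp add: inv_word_def)

lemma set_inv_word [simp]: "set (inv_word p) = flip ` set p"
  by (simp add: inv_word_def)

lemma last_inv_word: "p \<noteq> [] \<Longrightarrow> last (inv_word p) = flip (hd p)"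
  by (cases p) auto

lemma reduced_inv_word [simp]: "reduced (inv_word p) \<longleftrightarrow> reduced p"
proof -
  have "reduced (inv_word p)" if "reduced p" for p
    using that
    by (induction p) (auto simp: reduced_append reduced_Cons last_inv_word)
  then show ?thesis
    by (metis inv_word_inv_word)
qed

lemma act_inv_word [simp]: "reduced w \<Longrightarrow> act (inv_word p) (act p w) = w"
  by (induction p arbitrary: w) auto

lemma act_act_inv_word [simp]: "reduced w \<Longrightarrow> act p (act (inv_word p) w) = w"
  using act_inv_word[of w "inv_word p"] by simp


section \<open>Translation-commensurable sets of words\<close>

text \<open>The letter \<open>(n, True)\<close> is the generator \<open>x\<^sub>n\<close>, which is in use only if \<open>s n \<noteq> {}\<close>;
  \<open>side s\<close> is the subset \<open>S\<close> of the free group for which \<open>x\<^sub>n S\<close> and \<open>S\<close> differ exactly in \<open>s n\<close>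
  (lemma \<open>side_step\<close>).\<close>

primrec side :: "(nat \<Rightarrow> letter list set) \<Rightarrow> letter list \<Rightarrow> bool" where
  "side s [] = False"
| "side s (l # w) = (side s w \<noteq> ((if snd l then l # w else w) \<in> s (fst l)))"

definition words :: "(nat \<Rightarrow> letter list set) \<Rightarrow> letter list set" where
  "words s = {w. reduced w \<and> (\<forall>l\<in>set w. s (fst l) \<noteq> {})}"

definition words_below :: "(nat \<Rightarrow> letter list set) \<Rightarrow> nat \<Rightarrow> letter list set" where
  "words_below s n = {w \<in> words s. \<forall>l\<in>set w. fst l < n}"

text \<open>The rule compares the two ends of an edge from \<open>v\<close> to \<open>x_n v\<close>
  and always tests the end \<open>x_n v\<close>, so it is the same whether or not \<open>l\<close>
  cancels.\<close>

lemma side_step: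
  assumes "reduced w"
  shows "side s (step l w) = (side s w \<noteq> ((if snd l then step l w else w) \<in> s (fst l)))"
  using assms by (cases rule: step_cases[of w l]) auto

lemma words_reduced: "w \<in> words s \<Longrightarrow> reduced w"
  by (simp add: words_def)

lemma words_letters: "w \<in> words s \<Longrightarrow> \<forall>l\<in>set w. s (fst l) \<noteq> {}"
  by (simp add: words_def)

lemma words_below_letters: "w \<in> words_below s n \<Longrightarrow> \<forall>l\<in>set w. s (fst l) \<noteq> {} \<and> fst l < n"
  by (simp add: words_below_def words_def)

lemma words_below_subset: "words_below s n \<subseteq> words s"
  by (auto simp: words_below_def)

lemma words_below_reduced: "w \<in> words_below s n \<Longrightarrow> reduced w"
  using words_below_subset words_reduced by blast

lemma words_below_mono: "m \<le> n \<Longrightarrow> words_below s m \<subseteq> words_below s n"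
  by (force simp: words_below_def)

lemma Nil_in_words [simp]: "[] \<in> words s" "[] \<in> words_below s n"
  by (auto simp: words_def words_below_def)

lemma step_in_words_iff:
  "reduced w \<Longrightarrow> s (fst l) \<noteq> {} \<Longrightarrow> step l w \<in> words s \<longleftrightarrow> w \<in> words s"
  by (cases rule: step_cases[of w l]) (auto simp: words_def reduced_Cons)

lemma step_in_words_below_iff:
  "reduced w \<Longrightarrow> s (fst l) \<noteq> {} \<Longrightarrow> fst l < n \<Longrightarrow> step l w \<in> words_below s n \<longleftrightarrow> w \<in> words_below s n"
  by (cases rule: step_cases[of w l]) (auto simp: words_below_def words_def reduced_Cons)

lemma act_in_words_iff:
  "reduced w \<Longrightarrow> \<forall>l\<in>set p. s (fst l) \<noteq> {} \<Longrightarrow> act p w \<in> words s \<longleftrightarrow> w \<in> words s"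
  by (induction p) (auto simp: step_in_words_iff)

lemma act_in_words_below_iff:
  "reduced w \<Longrightarrow> \<forall>l\<in>set p. s (fst l) \<noteq> {} \<and> fst l < n \<Longrightarrow>
    act p w \<in> words_below s n \<longleftrightarrow> w \<in> words_below s n"
  by (induction p) (auto simp: step_in_words_below_iff)

lemma inv_word_in_words [simp]: "inv_word w \<in> words s \<longleftrightarrow> w \<in> words s"
  by (auto simp: words_def)

lemma inv_word_in_words_below [simp]: "inv_word w \<in> words_below s n \<longleftrightarrow> w \<in> words_below s n"
  by (auto simp: words_below_def)

lemma act_in_words: "w \<in> words s \<Longrightarrow> p \<in> words s \<Longrightarrow> act p w \<in> words s"
  by (rule act_in_words_iff[THEN iffD2, OF words_reduced words_letters])

lemma act_in_words_below:
  "w \<in> words_below s n \<Longrightarrow> p \<in> words_below s n \<Longrightarrow> act p w \<in> words_below s n"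
  by (rule act_in_words_below_iff[THEN iffD2, OF words_below_reduced words_below_letters])

lemma inj_on_act: "inj_on (act p) (words s)"
  by (rule inj_on_inverseI[of _ "act (inv_word p)"]) (simp add: words_reduced)

lemma finite_subset_words_below:
  assumes "finite a" "a \<subseteq> words s"
  obtains N where "a \<subseteq> words_below s N"
proof
  let ?L = "fst ` (\<Union>w\<in>a. set w)"
  have "finite ?L" using assms by auto
  then have "\<forall>k\<in>?L. k < Suc (Max ?L)" by (auto simp: less_Suc_eq_le)
  then show "a \<subseteq> words_below s (Suc (Max ?L))"
    using assms(2) by (auto simp: words_below_def)
qed

section \<open>Membership and its invariance under left translation\<close>

definition mem :: "(nat \<Rightarrow> letter list set) \<Rightarrow> letter list \<Rightarrow> letter list \<Rightarrow> bool" where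
  "mem s u v = side s (act (inv_word v) u)"

lemma mem_Cons: "mem s u (l # v) = mem s (step (flip l) u) v"
  by (simp add: mem_def)

lemma mem_step:
  assumes "reduced u" "reduced v"
  shows "mem s (step l u) (step l v) = mem s u v"
  using assms(2)
proof (cases rule: step_cases[of v l])
  case 1
  then show ?thesis using assms by (simp add: mem_Cons)
next
  case (2 w')
  then show ?thesis using mem_Cons[of s u "flip l" w'] by simp
qed

lemma mem_act: "reduced u \<Longrightarrow> reduced v \<Longrightarrow> mem s (act p u) (act p v) = mem s u v"
  by (induction p) (auto simp: mem_step)

text \<open>\<open>fixes_modification s N w\<close>: within the subgroup generated by \<open>x\<^sub>0, \<dots>, x\<^sub>N\<^sub>-\<^sub>1\<close>, left
  translation by \<open>w\<close> stabilises some finite modification of \<open>S\<close>.\<close>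

definition fixes_modification :: "(nat \<Rightarrow> letter list set) \<Rightarrow> nat \<Rightarrow> letter list \<Rightarrow> bool" where
  "fixes_modification s N w \<longleftrightarrow>
    (\<exists>A. finite {u \<in> words_below s N. (u \<in> A) \<noteq> side s u} \<and>
         (\<forall>u\<in>words_below s N. act w u \<in> A \<longleftrightarrow> u \<in> A))"

lemma fixes_modification_cong:
  assumes "fixes_modification s N v" "\<And>u. u \<in> words_below s N \<Longrightarrow> act v u = act w u"
  shows "fixes_modification s N w"
proof -
  obtain A where "finite {u \<in> words_below s N. (u \<in> A) \<noteq> side s u}"
      "\<forall>u\<in>words_below s N. act v u \<in> A \<longleftrightarrow> u \<in> A"
    using assms(1) unfolding fixes_modification_def by blast
  then show ?thesis
    unfolding fixes_modification_def using assms(2) by (intro exI[of _ A]) simp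
qed

text \<open>By \<open>s_new\<close> a generator is used only for a modification that no older word
  realises on the older words, which gives extensionality. By \<open>s_complete\<close> every
  nonempty finite modification comes from a generator or an older word, which gives the other
  axioms.\<close>

locale free_system =
  fixes s :: "nat \<Rightarrow> letter list set"
  assumes s_below: "s n \<subseteq> words_below s n"
    and finite_s: "finite (s n)"
    and s_new: "s n \<noteq> {} \<Longrightarrow> h \<in> words_below s n \<Longrightarrow>
      \<exists>u\<in>words_below s n. side s (act h u) \<noteq> (side s u \<noteq> (u \<in> s n))"
    and s_complete: "finite a \<Longrightarrow> a \<subseteq> words s \<Longrightarrow>
      \<exists>n. a \<subseteq> words_below s n \<and> (s n = a \<or>
        (\<exists>h\<in>words_below s n. \<forall>u\<in>words_below s n. side s (act h u) = (side s u \<noteq> (u \<in> a))))"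
begin

text \<open>Both ends of the edge miss \<open>s (fst l)\<close>: \<open>w\<close> because it is not
  a word below \<open>n\<close>, \<open>l # w\<close> because it contains \<open>l\<close>.\<close>

lemma side_Cons_outside:
  assumes "w \<notin> words_below s n" "fst l \<le> n" "reduced (l # w)" "s (fst l) \<noteq> {}"
  shows "side s (l # w) = side s w"
proof -
  have "w \<notin> s (fst l)"
    using assms(1,2) s_below[of "fst l"] words_below_mono[OF assms(2), of s] by blast
  moreover have "l # w \<notin> s (fst l)"
    using s_below[of "fst l"] by (auto simp: words_below_def)
  ultimately show ?thesis by simp
qed

lemma side_append_outside:
  assumes "reduced (p @ w)" "w \<notin> words_below s n" "\<forall>l\<in>set p. fst l \<le> n \<and> s (fst l) \<noteq> {}"
  shows "side s (p @ w) = side s w"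
  using assms
proof (induction p)
  case (Cons l p)
  have "p @ w \<notin> words_below s n"
    using Cons.prems by (auto simp: words_below_def words_def reduced_append)
  then have "side s (l # p @ w) = side s (p @ w)"
    using Cons.prems by (intro side_Cons_outside[where n = n]) auto
  with Cons show ?case by (simp add: reduced_Cons)
qed simp

text \<open>Translation by the subgroup below \<open>n\<close> preserves its complement, which meets
  no \<open>s (fst l)\<close> with \<open>fst l < n\<close>.\<close>

lemma side_act_outside:
  assumes "w \<in> words s" "w \<notin> words_below s n" "\<forall>l\<in>set p. s (fst l) \<noteq> {} \<and> fst l < n"
  shows "side s (act p w) = side s w"
  using assms(3)
proof (induction p)
  case (Cons l p)
  have red: "reduced (act p w)" using assms(1) by (simp add: words_reduced)
  have "act p w \<notin> words_below s n" "step l (act p w) \<notin> words_below s n"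
    using Cons.prems assms red
    by (simp_all add: act_in_words_below_iff step_in_words_below_iff words_reduced)
  moreover have "s (fst l) \<subseteq> words_below s n"
    using s_below[of "fst l"] words_below_mono[of "fst l" n s] Cons.prems by auto
  ultimately show ?case
    using Cons side_step[OF red, of s l] by auto
qed simp

text \<open>Each letter of \<open>p\<close> alters \<open>side\<close> only on the preimage of a
  finite set under an injective translation.\<close>

lemma finite_side_act:
  assumes "\<forall>l\<in>set p. s (fst l) \<noteq> {}"
  shows "finite {u \<in> words s. side s (act p u) \<noteq> side s u}"
  using assms
proof (induction p)
  case (Cons l p)
  let ?f = "act (if snd l then l # p else p)"
  have "inj_on ?f (words s)"
    by (rule inj_on_act)
  then have "finite (?f -` s (fst l) \<inter> words s)"
    using finite_s by (rule finite_vimage_IntI[rotated])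
  moreover have "{u \<in> words s. side s (act (l # p) u) \<noteq> side s u}
      \<subseteq> {u \<in> words s. side s (act p u) \<noteq> side s u} \<union> (?f -` s (fst l) \<inter> words s)"
    by (auto simp: side_step words_reduced)
  ultimately show ?case
    using Cons by (auto intro: finite_subset)
qed simp

text \<open>\<open>q @ p\<close> is a conjugate of \<open>p @ q\<close>; it fixes the translate
  \<open>A'\<close> of \<open>A\<close> by \<open>p^-1\<close>, still a finite modification by
  \<open>finite_side_act\<close>.\<close>

lemma fixes_modification_rotate:
  assumes "fixes_modification s N (p @ q)"
    and p: "\<forall>l\<in>set p. s (fst l) \<noteq> {} \<and> fst l < N" and q: "\<forall>l\<in>set q. s (fst l) \<noteq> {} \<and> fst l < N"
  shows "fixes_modification s N (q @ p)"
proof -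
  obtain A where fin: "finite {u \<in> words_below s N. (u \<in> A) \<noteq> side s u}"
    and inv: "\<forall>u\<in>words_below s N. act (p @ q) u \<in> A \<longleftrightarrow> u \<in> A"
    using assms(1) unfolding fixes_modification_def by blast
  define A' where "A' = {u. act p u \<in> A}"
  have act_below: "act p u \<in> words_below s N" if "u \<in> words_below s N" for u
    using that p by (simp add: act_in_words_below_iff words_below_reduced)
  have "inj_on (act p) (words_below s N)"
    using inj_on_act words_below_subset by (rule inj_on_subset)
  with fin have "finite (act p -` {u \<in> words_below s N. (u \<in> A) \<noteq> side s u} \<inter> words_below s N)"
    by (rule finite_vimage_IntI)
  moreover have "finite {u \<in> words s. side s (act p u) \<noteq> side s u}"
    using p by (intro finite_side_act) blast
  moreover have "{u \<in> words_below s N. (u \<in> A') \<noteq> side s u}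
      \<subseteq> (act p -` {u \<in> words_below s N. (u \<in> A) \<noteq> side s u} \<inter> words_below s N)
        \<union> {u \<in> words s. side s (act p u) \<noteq> side s u}"
    using act_below words_below_subset by (auto simp: A'_def)
  ultimately have "finite {u \<in> words_below s N. (u \<in> A') \<noteq> side s u}"
    by (meson finite_UnI finite_subset)
  moreover have "\<forall>u\<in>words_below s N. act (q @ p) u \<in> A' \<longleftrightarrow> u \<in> A'"
    using inv act_below by (simp add: A'_def)
  ultimately show ?thesis unfolding fixes_modification_def by blast
qed

text \<open>No letter of \<open>u\<close> has index \<open>n\<close>, so nothing cancels against
  \<open>l\<close>, and the letters of \<open>z\<close> meet only words outside the subgroup below
  \<open>n\<close>.\<close>

lemma act_top_letter:
  assumes "reduced (z @ [l])" "fst l = n" "\<forall>l\<in>set (z @ [l]). fst l \<le> n \<and> s (fst l) \<noteq> {}"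
    and "u \<in> words_below s n"
  shows "act (z @ [l]) u = z @ l # u" "side s (z @ l # u) = side s (l # u)"
proof -
  have "reduced (l # u)"
    using assms by (cases u) (auto simp: reduced_Cons words_below_def words_def)
  then have red: "reduced (z @ l # u)"
    using assms(1) by (auto simp: reduced_append)
  then show "act (z @ [l]) u = z @ l # u"
    using act_reduced[of "z @ [l]" u] by simp
  show "side s (z @ l # u) = side s (l # u)"
    using red assms by (intro side_append_outside[where n = n]) (auto simp: words_below_def)
qed

text \<open>A shortest \<open>w\<close> fixing some modification \<open>A\<close> is cyclically reduced and may be
  rotated. Rotate it so that it ends with its top generator \<open>x\<^sub>n\<close> or its inverse. For \<open>u\<close> without
  the letter \<open>x\<^sub>n\<close>, membership of \<open>u\<close> in \<open>A\<close> agrees with that of \<open>w\<^sup>k u\<close> and \<open>w\<^sup>-\<^sup>k u\<close> in \<open>S\<close> for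
  large \<open>k\<close>; comparing the two contradicts the choice of \<open>s n\<close> or the minimality of \<open>w\<close>.\<close>

lemma no_fixed_modification:
  "w \<in> words_below s N \<Longrightarrow> w \<noteq> [] \<Longrightarrow> \<not> fixes_modification s N w"
proof (induction "length w" arbitrary: w N rule: less_induct)
  case less
  show ?case
  proof
    assume fix_w: "fixes_modification s N w"
    have letters: "\<forall>l\<in>set w. s (fst l) \<noteq> {} \<and> fst l < N" and red: "reduced w"
      using less.prems words_below_letters words_below_reduced by blast+
    \<comment> \<open>Otherwise conjugating away the outer letters leaves the shorter nonempty word
      \<open>v\<close>, against minimality.\<close>
    have cyc: "hd w \<noteq> flip (last w)"
    proof
      assume eq: "hd w = flip (last w)"
      obtain l w1 where w1: "w = l # w1" using less.prems by (cases w) auto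
      then have "w1 \<noteq> []" using eq by auto
      then obtain v k where "w1 = v @ [k]" by (metis rev_exhaust)
      with w1 eq have w: "w = [flip k] @ (v @ [k])" by simp
      have "v \<noteq> []" using red unfolding w by (auto simp: reduced_Cons)
      have "fixes_modification s N ((v @ [k]) @ [flip k])"
        using fixes_modification_rotate[of N "[flip k]" "v @ [k]"] fix_w letters unfolding w by simp
      moreover have "act ((v @ [k]) @ [flip k]) u = act v u" if "u \<in> words_below s N" for u
        using that by (simp add: words_below_reduced)
      ultimately have "fixes_modification s N v"
        by (rule fixes_modification_cong)
      moreover have "v \<in> words_below s N"
        using less.prems(1) unfolding w
        by (simp add: words_below_def words_def reduced_Cons reduced_append)
      ultimately show False
        using less.hyps[of v N] w \<open>v \<noteq> []\<close> by simp
    qed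
    define n where "n = Max (fst ` set w)"
    have n: "n \<in> fst ` set w" and n_max: "\<forall>l\<in>set w. fst l \<le> n"
      using less.prems(2) by (auto simp: n_def)
    \<comment> \<open>Preferring the positive letter excludes the combination
      \<open>\<not> e\<close>, \<open>e'\<close> later on.\<close>
    obtain e where e: "(n, e) \<in> set w" "e \<or> (n, True) \<notin> set w"
      using n by (cases "(n, True) \<in> set w") auto
    obtain p q where pq: "w = p @ (n, e) # q"
      using e(1) by (meson split_list)
    define w' where "w' = q @ p @ [(n, e)]"
    have set_w': "set w' = set w" and len_w': "length w' = length w"
      by (auto simp: w'_def pq)
    have "fixes_modification s N (q @ (p @ [(n, e)]))"
      using fixes_modification_rotate[of N "p @ [(n, e)]" q] fix_w letters unfolding pq by simp
    then have fix_w': "fixes_modification s N w'"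
      by (simp add: w'_def)
    have red': "reduced w'"
      using red cyc by (cases p; cases q rule: rev_cases)
        (auto simp: w'_def pq reduced_append reduced_Cons hd_append)
    have cyc': "hd w' \<noteq> flip (last w')"
      using red cyc by (cases q; cases p)
        (auto simp: w'_def pq reduced_append reduced_Cons)
    have "\<exists>l\<in>set w'. fst l = n" by (auto simp: w'_def)
    from split_list_first_prop[OF this] obtain h l r
      where "w' = h @ l # r" "fst l = n" and h_n: "\<forall>l\<in>set h. fst l \<noteq> n"
      by blast
    then obtain e' where w'_eq: "w' = h @ (n, e') # r" by (cases l) auto
    have "(n, e') \<in> set w" using w'_eq set_w'[symmetric] by simp
    then have e': "e \<or> \<not> e'" using e(2) by (cases e') simp_all
    have letters': "\<forall>l\<in>set w'. s (fst l) \<noteq> {} \<and> fst l < N \<and> fst l \<le> n"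
      using letters n_max set_w' by simp
    have h: "h \<in> words_below s n"
    proof -
      have "\<forall>l\<in>set h. s (fst l) \<noteq> {} \<and> fst l < n"
        using letters' h_n w'_eq by (simp add: order.strict_iff_order)
      then show ?thesis
        using red' by (simp add: words_below_def words_def w'_eq reduced_append)
    qed
    have "n < N" using letters' w'_eq by simp
    then have sub: "words_below s n \<subseteq> words_below s N"
      by (simp add: words_below_mono)
    obtain A where fin: "finite {u \<in> words_below s N. (u \<in> A) \<noteq> side s u}"
      and inv: "\<forall>u\<in>words_below s N. act w' u \<in> A \<longleftrightarrow> u \<in> A"
      using fix_w' unfolding fixes_modification_def by blast
    \<comment> \<open>Words of length at least \<open>k\<close> lie outside the finite exceptional
      set; if that set is empty, the unspecified value of \<open>Max\<close> is harmless.\<close>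
    define k where "k = Suc (Max (length ` {u \<in> words_below s N. (u \<in> A) \<noteq> side s u}))"
    have A_side: "u \<in> A \<longleftrightarrow> side s u" if "u \<in> words_below s N" "k \<le> length u" for u
    proof (rule ccontr)
      assume "\<not> (u \<in> A \<longleftrightarrow> side s u)"
      with that(1) fin have "length u < k"
        by (auto simp: k_def less_Suc_eq_le intro!: Max_ge)
      with that(2) show False by simp
    qed
    have act_below: "act v u \<in> words_below s N"
      if "u \<in> words_below s N" "v = w' \<or> v = inv_word w'" for u v
    proof -
      have "\<forall>l\<in>set v. s (fst l) \<noteq> {} \<and> fst l < N"
        using that(2) letters' by (elim disjE) simp_all
      with that(1) show ?thesis
        by (simp add: act_in_words_below_iff words_below_reduced)
    qed
    have inv': "act (inv_word w') u \<in> A \<longleftrightarrow> u \<in> A" if "u \<in> words_below s N" for u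
      using inv[rule_format, of "act (inv_word w') u"] act_below[OF that] that
      by (simp add: words_below_reduced)
    have pow: "act (concat (replicate j v)) u \<in> words_below s N \<and>
        (act (concat (replicate j v)) u \<in> A \<longleftrightarrow> u \<in> A)"
      if "u \<in> words_below s N" "v = w' \<or> v = inv_word w'" for u v j
      using that inv inv' act_below by (induction j) auto
    \<comment> \<open>Apply the power of \<open>v\<close> with exponent \<open>Suc k\<close> to
      \<open>u\<close>: membership in \<open>A\<close> is unchanged, the result is long enough for
      \<open>side\<close> to decide, and everything left of the last top letter \<open>l\<close> may
      be dropped.\<close>
    have A_power: "u \<in> A \<longleftrightarrow> side s (l # act y u)"
      if v: "v = w' \<or> v = inv_word w'" and v_eq: "v = x @ l # y"
        and y: "y \<in> words_below s n" and "fst l = n" and u: "u \<in> words_below s n"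
      for u v x y l
    proof -
      have "w' \<noteq> []" by (simp add: w'_eq)
      then have "hd v \<noteq> flip (last v)"
        using cyc' v by (auto simp: last_inv_word hd_rev inv_word_def hd_map last_map last_rev)
      moreover have "reduced v" using red' v by auto
      ultimately have "reduced (concat (replicate (Suc k) v))"
        by (rule reduced_concat_replicate[rotated])
      moreover define z where "z = concat (replicate k v) @ x"
      have eq: "concat (replicate (Suc k) v) = z @ l # y"
        by (simp add: z_def v_eq flip: replicate_append_same)
      ultimately have "reduced (z @ l # y)" by (simp only:)
      then have red_z: "reduced (z @ [l])"
        by (simp add: reduced_append reduced_Cons)
      have "\<forall>l\<in>set v. fst l \<le> n \<and> s (fst l) \<noteq> {}"
        using v letters' by (elim disjE) simp_all
      then have z: "\<forall>l\<in>set (z @ [l]). fst l \<le> n \<and> s (fst l) \<noteq> {}"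
        by (auto simp: z_def v_eq)
      have "act y u \<in> words_below s n"
        using u y by (rule act_in_words_below)
      note top = act_top_letter[OF red_z \<open>fst l = n\<close> z this]
      have "length (concat (replicate k v)) \<ge> k"
        by (induction k) (auto simp: v_eq)
      then have len: "k \<le> length (z @ l # act y u)" by (simp add: z_def)
      have "act (concat (replicate (Suc k) v)) u = z @ l # act y u"
        unfolding eq using top(1) by simp
      with pow[OF _ v, of u "Suc k"] u sub
      have "z @ l # act y u \<in> words_below s N" "z @ l # act y u \<in> A \<longleftrightarrow> u \<in> A"
        by auto
      with A_side len top(2) show ?thesis by simp
    qed
    have s_n: "s n \<noteq> {}" using letters' w'_eq by simp
    \<comment> \<open>Positive powers of \<open>w'\<close> end in \<open>(n, e)\<close>, negative
      ones in the flipped first top letter followed by \<open>inv_word h\<close>.\<close>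
    have side_eq: "side s ((n, e) # u) = side s ((n, \<not> e') # act (inv_word h) u)"
      if "u \<in> words_below s n" for u
    proof -
      have "w' = (q @ p) @ (n, e) # []" by (simp add: w'_def)
      from A_power[OF _ this _ _ that] have "u \<in> A \<longleftrightarrow> side s ((n, e) # u)"
        by (simp del: side.simps)
      moreover have "inv_word w' = inv_word r @ (n, \<not> e') # inv_word h"
        by (simp add: w'_eq flip_def)
      from A_power[OF _ this _ _ that]
      have "u \<in> A \<longleftrightarrow> side s ((n, \<not> e') # act (inv_word h) u)"
        using h by (simp del: side.simps)
      ultimately show ?thesis by (simp del: side.simps)
    qed
    have side_pos: "side s ((n, True) # u) = side s u" if "u \<in> words_below s n" for u
      using s_below[of n] by (auto simp: words_below_def)
    have side_neg: "side s ((n, False) # u) = (side s u \<noteq> (u \<in> s n))" for u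
      by simp
    \<comment> \<open>If the signs agree, a word below \<open>n\<close> realises the modification by
      \<open>s n\<close>, against \<open>s_new\<close>; if they differ, \<open>inv_word h\<close>
      preserves \<open>S\<close> below \<open>n\<close> and is shorter than
      \<open>w\<close>.\<close>
    consider "e" "e'" | "\<not> e" "\<not> e'" | "e" "\<not> e'" using e' by blast
    then show False
    proof cases
      case 1
      obtain u where u: "u \<in> words_below s n" "side s (act h u) \<noteq> (side s u \<noteq> (u \<in> s n))"
        using s_new[OF s_n h] by blast
      then have hu: "act h u \<in> words_below s n" using h by (simp add: act_in_words_below)
      from side_eq[OF hu] u 1 show False
        by (simp add: side_pos[OF hu] side_neg words_below_reduced del: side.simps)
    next
      case 2
      obtain u where u: "u \<in> words_below s n"
          "side s (act (inv_word h) u) \<noteq> (side s u \<noteq> (u \<in> s n))"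
        using s_new[OF s_n, of "inv_word h"] h by auto
      then have hu: "act (inv_word h) u \<in> words_below s n"
        using h by (simp add: act_in_words_below)
      from side_eq[OF u(1)] u(2) 2 show False
        by (simp add: side_pos[OF hu] side_neg del: side.simps)
    next
      case 3
      have "last w' = (n, e)" by (simp add: w'_def)
      moreover have "h = [] \<Longrightarrow> hd w' = (n, e')" by (simp add: w'_eq)
      ultimately have "h \<noteq> []" using cyc' 3 by (auto simp: flip_def)
      have "side s (act (inv_word h) u) = side s u" if "u \<in> words_below s n" for u
      proof -
        have hu: "act (inv_word h) u \<in> words_below s n"
          using h that by (simp add: act_in_words_below)
        from side_eq[OF that] 3 show ?thesis
          by (simp add: side_pos[OF hu] side_pos[OF that] del: side.simps)
      qed
      then have "fixes_modification s n (inv_word h)"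
        unfolding fixes_modification_def by (intro exI[of _ "{u. side s u}"]) simp
      moreover have "length (inv_word h) < length w"
        using len_w' w'_eq by simp
      ultimately show False
        using less.hyps[of "inv_word h" n] h \<open>h \<noteq> []\<close> by simp
    qed
  qed
qed

section \<open>Extensions of words are exactly the finite modifications of \<open>S\<close>, each
  attained once\<close>

lemma mem_extensional:
  assumes "v \<in> words s" "v' \<in> words s" and eq: "\<And>u. u \<in> words s \<Longrightarrow> mem s u v = mem s u v'"
  shows "v = v'"
proof (rule ccontr)
  assume "v \<noteq> v'"
  \<comment> \<open>Equal extensions make \<open>S\<close> itself stable under
    \<open>v^-1 v'\<close>.\<close>
  define w where "w = act (inv_word v) v'"
  have w: "w \<in> words s" using assms by (simp add: w_def act_in_words)
  have "w \<noteq> []"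
  proof
    assume "w = []"
    then have "act v (act (inv_word v) v') = act v []" by (simp add: w_def)
    with assms \<open>v \<noteq> v'\<close> show False by (simp add: words_reduced act_right_Nil)
  qed
  have "side s (act w u) = side s u" if "u \<in> words s" for u
    using eq[of "act v' u"] assms that
    by (simp add: w_def mem_def act_act words_reduced act_in_words)
  then have "fixes_modification s N w" for N
    unfolding fixes_modification_def
    using words_below_subset[of s N] by (intro exI[of _ "{u. side s u}"]) auto
  moreover obtain N where "w \<in> words_below s N"
    using finite_subset_words_below[of "{w}" s] w by auto
  ultimately show False using no_fixed_modification \<open>w \<noteq> []\<close> by blast
qed

lemma finite_mem_side:
  assumes "v \<in> words s"
  shows "finite {u \<in> words s. mem s u v \<noteq> side s u}"
  unfolding mem_def using assms by (intro finite_side_act words_letters) simp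

lemma mem_surjective:
  assumes "finite {u \<in> words s. P u \<noteq> side s u}"
  obtains v where "v \<in> words s" "\<And>u. u \<in> words s \<Longrightarrow> mem s u v = P u"
proof -
  define a where "a = {u \<in> words s. P u \<noteq> side s u}"
  have P: "P u = (side s u \<noteq> (u \<in> a))" if "u \<in> words s" for u
    using that by (auto simp: a_def)
  have a: "finite a" "a \<subseteq> words s"
    using assms by (auto simp: a_def)
  from s_complete[OF a] obtain n where n: "a \<subseteq> words_below s n"
    and cases: "s n = a \<or>
      (\<exists>h\<in>words_below s n. \<forall>u\<in>words_below s n. side s (act h u) = (side s u \<noteq> (u \<in> a)))"
    by blast
  show ?thesis
  \<comment> \<open>For empty \<open>a\<close>, \<open>s n = a\<close> only says that the generator
    is not in use; then \<open>h = []\<close> serves.\<close>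
  proof (cases "s n = a \<and> a \<noteq> {}")
    case True
    show ?thesis
    proof (rule that)
      show "[(n, True)] \<in> words s" using True by (auto simp: words_def reduced_Cons)
      show "mem s u [(n, True)] = P u" if "u \<in> words s" for u
        using that True P[OF that] by (simp add: mem_def side_step words_reduced flip_def)
    qed
  next
    case False
    obtain h where h: "h \<in> words_below s n"
      and eq: "\<And>u. u \<in> words_below s n \<Longrightarrow> side s (act h u) = (side s u \<noteq> (u \<in> a))"
    proof (cases "a = {}")
      case True
      then show ?thesis using that[of "[]"] by simp
    next
      case nonempty: False
      with False cases that show ?thesis by blast
    qed
    show ?thesis
    proof (rule that)
      show "inv_word h \<in> words s" using h words_below_subset by auto
      show "mem s u (inv_word h) = P u" if u: "u \<in> words s" for u
      \<comment> \<open>Outside the subgroup below \<open>n\<close>, translation by \<open>h\<close>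
        changes nothing and \<open>a\<close> has no elements.\<close>
      proof (cases "u \<in> words_below s n")
        case True
        then show ?thesis using eq P[OF u] by (simp add: mem_def)
      next
        case False
        then have "side s (act h u) = side s u"
          using u words_below_letters[OF h] by (intro side_act_outside)
        then show ?thesis using False n P[OF u] by (auto simp: mem_def)
      qed
    qed
  qed
qed

end


section \<open>Existence of a free system\<close>

text \<open>Stage \<open>n\<close> treats the finite set coded by the first component of \<open>n\<close>, so that each finite
  set comes up again after all the letters occurring in it have been introduced.\<close>

definition next_relator :: "(nat \<Rightarrow> letter list set) \<Rightarrow> nat \<Rightarrow> letter list set" where
  "next_relator s n =
    (let a = from_nat_into (Collect finite) (fst (prod_decode n)) in
     if a \<subseteq> words_below s n \<and>
        (\<forall>h\<in>words_below s n. \<exists>u\<in>words_below s n. side s (act h u) \<noteq> (side s u \<noteq> (u \<in> a)))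
     then a else {})"

text \<open>The cut-off at \<open>n\<close> makes the recursion well-founded;
  \<open>system_eq\<close> removes it, since \<open>next_relator\<close> inspects only indices below
  \<open>n\<close>.\<close>

fun system :: "nat \<Rightarrow> letter list set" where
  "system n = next_relator (\<lambda>i. if i < n then system i else {}) n"

declare system.simps [simp del]

lemma words_below_cong:
  assumes "\<And>i. i < n \<Longrightarrow> s i = t i"
  shows "words_below s n = words_below t n"
proof -
  have "(\<forall>l\<in>set w. s (fst l) \<noteq> {}) = (\<forall>l\<in>set w. t (fst l) \<noteq> {})" if "\<forall>l\<in>set w. fst l < n" for w
    using assms that by (intro ball_cong) auto
  then show ?thesis
    by (auto simp only: words_below_def words_def mem_Collect_eq)
qed

lemma side_cong:
  "(\<And>i. i < n \<Longrightarrow> s i = t i) \<Longrightarrow> \<forall>l\<in>set w. fst l < n \<Longrightarrow> side s w = side t w"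
  by (induction w) auto

lemma next_relator_cong:
  assumes "\<And>i. i < n \<Longrightarrow> s i = t i"
  shows "next_relator s n = next_relator t n"
proof -
  have words: "words_below s n = words_below t n"
    using assms by (rule words_below_cong)
  have side: "side s u = side t u" if "u \<in> words_below t n" for u
    using assms that by (intro side_cong[of n]) (auto simp: words_below_def)
  show ?thesis
    unfolding next_relator_def words by (simp add: side act_in_words_below cong: ball_cong bex_cong)
qed

lemma system_eq: "system n = next_relator system n"
  by (subst system.simps) (rule next_relator_cong, simp)

lemma finite_from_nat_into_finite: "finite (from_nat_into (Collect finite) k)"
  using from_nat_into[of "Collect finite" k] by auto

interpretation free_system system
proof
  show "system n \<subseteq> words_below system n" for n
    by (subst system_eq) (simp add: next_relator_def Let_def)
  show "finite (system n)" for n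
    by (subst system_eq) (simp add: next_relator_def Let_def finite_from_nat_into_finite)
next
  fix n h
  assume "system n \<noteq> {}" "h \<in> words_below system n"
  then show "\<exists>u\<in>words_below system n. side system (act h u) \<noteq> (side system u \<noteq> (u \<in> system n))"
    using system_eq[of n] unfolding next_relator_def Let_def by (metis (no_types, lifting))
next
  fix a :: "letter list set"
  assume a: "finite a" "a \<subseteq> words system"
  then obtain N where N: "a \<subseteq> words_below system N"
    by (rule finite_subset_words_below)
  obtain k where k: "from_nat_into (Collect finite) k = a"
    using from_nat_into_surj[of "Collect finite" a] a(1) countable_Collect_finite by auto
  \<comment> \<open>Pairing with \<open>N\<close> gives \<open>N \<le> n\<close>, so all letters of
    \<open>a\<close> are available at stage \<open>n\<close>.\<close>
  define n where "n = prod_encode (k, N)"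
  have "a \<subseteq> words_below system n"
    using N words_below_mono[of N n system] le_prod_encode_2[of N k] by (auto simp: n_def)
  moreover have "fst (prod_decode n) = k" by (simp add: n_def)
  ultimately show "\<exists>n. a \<subseteq> words_below system n \<and> (system n = a \<or>
      (\<exists>h\<in>words_below system n. \<forall>u\<in>words_below system n.
        side system (act h u) = (side system u \<noteq> (u \<in> a))))"
    using system_eq[of n] k unfolding next_relator_def Let_def
    by (intro exI[of _ n]) (auto split: if_splits)
qed


section \<open>The model\<close>

text \<open>Words are countable, so \<open>to_nat\<close> moves the model to the natural
  numbers.\<close>

definition carrier :: "nat set" where
  "carrier = to_nat ` words system"

definition member :: "nat rel" where
  "member = {(to_nat u, to_nat v) | u v. u \<in> words system \<and> v \<in> words system \<and> mem system u v}"

lemma member_iff [simp]: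
  "u \<in> words system \<Longrightarrow> v \<in> words system \<Longrightarrow> (to_nat u, to_nat v) \<in> member \<longleftrightarrow> mem system u v"
  by (auto simp: member_def)

lemma is_structure_member: "is_structure carrier member"
  unfolding is_structure_def carrier_def member_def using Nil_in_words(1)[of system] by blast

lemma models_member: "models carrier member (WD \<union> EXT \<union> BU \<union> BI)"
proof -
  \<comment> \<open>In \<open>WD\<close>, \<open>BU\<close> and \<open>BI\<close> the condition on
    \<open>u\<close> agrees with \<open>S\<close> off a finite set \<open>D\<close>.\<close>
  have comprehension: "\<exists>z\<in>words system. \<forall>u\<in>words system. mem system u z = P u"
    if "finite D" and
      "\<And>u. u \<in> words system \<Longrightarrow> u \<notin> D \<Longrightarrow> P u = side system u" for D P
  proof -
    have "{u \<in> words system. P u \<noteq> side system u} \<subseteq> D" using that(2) by blast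
    then have "finite {u \<in> words system. P u \<noteq> side system u}"
      using \<open>finite D\<close> by (rule finite_subset)
    then show ?thesis by (rule mem_surjective) blast
  qed
  have fin: "finite {u \<in> words system. mem system u x \<noteq> side system u}" if "x \<in> words system" for x
    using that by (rule finite_mem_side)
  have WD: "\<exists>z\<in>words system. \<forall>u\<in>words system. mem system u z = (mem system u x \<or> u = y)"
      "\<exists>z\<in>words system. \<forall>u\<in>words system. mem system u z = (mem system u x \<and> u \<noteq> y)"
    if "x \<in> words system" for x y
    by (rule comprehension[OF finite.insertI[OF fin[OF that], of y]]; simp)+
  have BUI: "\<exists>z\<in>words system. \<forall>u\<in>words system. mem system u z = (mem system u x \<or> mem system u y)"
      "\<exists>z\<in>words system. \<forall>u\<in>words system. mem system u z = (mem system u x \<and> mem system u y)"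
    if "x \<in> words system" "y \<in> words system" for x y
    by (rule comprehension[OF finite_UnI[OF fin[OF that(1)] fin[OF that(2)]]], simp)+
  have EXT: "(\<forall>u\<in>words system. mem system u x = mem system u y) \<longleftrightarrow> x = y"
    if "x \<in> words system" "y \<in> words system" for x y
    using that mem_extensional by blast
  show ?thesis
    unfolding models_Un models_WD_iff[OF is_structure_member] models_EXT_iff[OF is_structure_member]
      models_BU_iff[OF is_structure_member] models_BI_iff[OF is_structure_member]
    by (simp add: carrier_def WD BUI EXT)
qed

lemma automorphism_act:
  assumes p: "p \<in> words system"
  shows "automorphism (\<lambda>k. to_nat (act p (from_nat k))) carrier member"
proof -
  have "bij_betw (\<lambda>k. to_nat (act p (from_nat k))) carrier carrier"
    by (rule bij_betw_byWitness[where f' = "\<lambda>k. to_nat (act (inv_word p) (from_nat k))"])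
      (auto simp: carrier_def words_reduced intro!: imageI act_in_words p)
  then show ?thesis
    using p by (auto simp: automorphism_def isomorphism_def carrier_def act_in_words mem_act
        words_reduced)
qed

theorem theorem1:
  "\<exists>(V :: nat set) (E :: nat rel).
     is_structure V E \<and>
     models V E (WD \<union> EXT \<union> BU \<union> BI) \<and>
     (\<forall>a\<in>V. \<forall>b\<in>V. \<exists>F. automorphism F V E \<and> F a = b)"
proof (rule exI[of _ carrier], rule exI[of _ member], intro conjI ballI)
  show "is_structure carrier member" by (rule is_structure_member)
  show "models carrier member (WD \<union> EXT \<union> BU \<union> BI)" by (rule models_member)
  fix a b assume "a \<in> carrier" "b \<in> carrier"
  then obtain u v where u: "u \<in> words system" "a = to_nat u" and v: "v \<in> words system" "b = to_nat v"
    by (auto simp: carrier_def)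
  \<comment> \<open>Translation by \<open>v u^-1\<close> sends \<open>u\<close> to
    \<open>v\<close>.\<close>
  let ?p = "act v (inv_word u)"
  have "act (inv_word u) u = []"
    using act_inv_word[of "[]" u] u by (simp add: act_right_Nil words_reduced)
  then have "act ?p u = v"
    using u v by (simp add: act_act act_right_Nil words_reduced)
  moreover have "?p \<in> words system"
    using u v by (simp add: act_in_words)
  ultimately have "automorphism (\<lambda>k. to_nat (act ?p (from_nat k))) carrier member \<and>
      to_nat (act ?p (from_nat a)) = b"
    using automorphism_act u v by simp
  then show "\<exists>F. automorphism F carrier member \<and> F a = b" by blast
qed

end
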